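(* Let $(\mathcal{P},\mathcal{B})$ be an $\mathrm{SRPG}(s,t;\alpha_1,\dots,\alpha_r;\lambda,\mu)$ with $v=|\mathcal{P}|$ points and incidence matrix $M$, and let $C(M)$ be the binary linear code with parity-check matrix $M$. Put $k=s(t+1)$, $\Delta=(\lambda-\mu)^2+4(k-\mu)$ and $n=v(t+1)/(s+1)$ (the number of blocks). Then the minimum distance $d$ of $C(M)$ satisfies $$d\ \ge\ \max\left\{\frac{n\,(4s-2t+2-\lambda+\mu-\sqrt{\Delta})}{2s(t+1)-\lambda+\mu-\sqrt{\Delta}},\ \ \frac{2n\,(4s-\lambda+\mu-\sqrt{\Delta})}{(t+1)\,(2s(t+1)-\lambda+\mu-\sqrt{\Delta})}\right\}.$$
   Context: A generalized partial geometry of grade $r$, denoted $\mathrm{PG}(s,t;\alpha_1,\dots,\alpha_r)$, is an incidence structure $(\mathcal{P},\mathcal{B})$, with $\mathcal{P}$ a finite non-empty set of points and $\mathcal{B}$ a family of subsets of $\mathcal{P}$ (blocks), incidence being containment, such that: (i) any two distinct points are incident with at most one common block; (ii) each block is incident with exactly $s+1$ points; (iii) each point is incident with exactly $t+1$ blocks; (iv) for any point $P$ and block $B$ with $P\notin B$, there is $\alpha\in\{\alpha_1,\dots,\alpha_r\}$ such that exactly $\alpha$ points of $B$ are joined to $P$ (two points are joined if some block contains both); (v) for each $\alpha\in\{\alpha_1,\dots,\alpha_r\}$ there exist a point $P$ and a block $B$ with $P\notin B$ such that exactly $\alpha$ points of $B$ are joined to $P$. The point graph of $(\mathcal{P},\mathcal{B})$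 has vertex set $\mathcal{P}$, two distinct points being adjacent if and only if some block contains both. A $k$-regular graph on $v$ vertices is strongly regular with parameters $(v,k,\lambda,\mu)$ if any two adjacent vertices have exactly $\lambda$ common neighbours and any two distinct non-adjacent vertices have exactly $\mu$ common neighbours. A $\mathrm{PG}(s,t;\alpha_1,\dots,\alpha_r)$ whose point graph is strongly regular with parameters $(v,k,\lambda,\mu)$ is denoted $\mathrm{SRPG}(s,t;\alpha_1,\dots,\alpha_r;\lambda,\mu)$; its parameters are $k=s(t+1)$ and $v=\frac{k(k-\lambda-1)}{\mu}+k+1$ (so $\mu\neq0$). The incidence matrix $M$ is the $v\times n$ $0/1$ matrix with rows indexed by points and columns by blocks, with entry $1$ exactly when the point lies on the block. $C(M)=\{c\in\mathbb{F}_2^n: Mc^T=0\}$, and its minimum distance is the minimum Hamming weight of a nonzero codeword. *)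

theory Defs
  imports Complex_Main "HOL-Library.Z2" "HOL-Library.Extended_Real"
begin

definition joined :: "'p set set \<Rightarrow> 'p \<Rightarrow> 'p \<Rightarrow> bool" where
  "joined \<B> x y \<longleftrightarrow> (\<exists>b\<in>\<B>. x \<in> b \<and> y \<in> b)"

text \<open>The argument \<open>A\<close> is the set of the numbers \<open>\<alpha>\<^sub>1, \<dots>, \<alpha>\<^sub>r\<close>. It is finite by
  \<open>alpha_attained\<close>, since the blocks are finite, and the grade is \<open>r = card A\<close>.\<close>

locale generalized_partial_geometry =
  fixes \<P> :: "'p set" and \<B> :: "'p set set" and s t :: nat and A :: "nat set"
  assumes finite_points: "finite \<P>"
    and points_nonempty: "\<P> \<noteq> {}"
    and blocks_subset: "\<And>b. b \<in> \<B> \<Longrightarrow> b \<subseteq> \<P>"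
    and at_most_one_block:
      "\<And>x y. \<lbrakk>x \<in> \<P>; y \<in> \<P>; x \<noteq> y\<rbrakk> \<Longrightarrow> \<exists>\<^sub>\<le>\<^sub>1 b. b \<in> \<B> \<and> x \<in> b \<and> y \<in> b"
    and points_on_block: "\<And>b. b \<in> \<B> \<Longrightarrow> card b = s + 1"
    and blocks_on_point: "\<And>x. x \<in> \<P> \<Longrightarrow> card {b \<in> \<B>. x \<in> b} = t + 1"
    and alpha_exists:
      "\<And>x b. \<lbrakk>x \<in> \<P>; b \<in> \<B>; x \<notin> b\<rbrakk> \<Longrightarrow> \<exists>\<alpha>\<in>A. card {y \<in> b. joined \<B> x y} = \<alpha>"
    and alpha_attained:
      "\<And>\<alpha>. \<alpha> \<in> A \<Longrightarrow> \<exists>x\<in>\<P>. \<exists>b\<in>\<B>. x \<notin> b \<and> card {y \<in> b. joined \<B> x y} = \<alpha>"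

definition point_adj :: "'p set set \<Rightarrow> 'p \<Rightarrow> 'p \<Rightarrow> bool" where
  "point_adj \<B> x y \<longleftrightarrow> x \<noteq> y \<and> joined \<B> x y"

locale strongly_regular_graph =
  fixes V :: "'a set" and adj :: "'a \<Rightarrow> 'a \<Rightarrow> bool" and v k lam mu :: nat
  assumes finite_vertices: "finite V"
    and adj_sym: "symp_on V adj"
    and adj_irrefl: "irreflp_on V adj"
    and card_vertices: "card V = v"
    and regular: "\<And>x. x \<in> V \<Longrightarrow> card {y \<in> V. adj x y} = k"
    and common_adj:
      "\<And>x y. \<lbrakk>x \<in> V; y \<in> V; adj x y\<rbrakk> \<Longrightarrow> card {z \<in> V. adj x z \<and> adj y z} = lam"
    and common_nonadj:
      "\<And>x y. \<lbrakk>x \<in> V; y \<in> V; x \<noteq> y; \<not> adj x y\<rbrakk> \<Longrightarrow> card {z \<in> V. adj x z \<and> adj y z} = mu"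

text \<open>The identity \<open>v = k (k - lam - 1) / mu + k + 1\<close> is not assumed: it follows from
  strong regularity by double counting as soon as \<open>mu \<noteq> 0\<close>.\<close>

locale srpg =
  generalized_partial_geometry \<P> \<B> s t A +
  strongly_regular_graph \<P> "point_adj \<B>" "card \<P>" "s * (t + 1)" lam mu
  for \<P> :: "'p set" and \<B> s t A lam mu +
  assumes mu_nonzero: "mu \<noteq> 0"

definition incidence_matrix :: "'p \<Rightarrow> 'p set \<Rightarrow> bit" where
  "incidence_matrix x b = (if x \<in> b then 1 else 0)"

text \<open>Matrices and vectors over the two-element field are functions on the index sets: \<open>I\<close>
  indexes the rows and \<open>J\<close> the columns. Vectors vanish outside \<open>J\<close>, so that each element of
  \<open>\<F>\<^sub>2\<^bsup>J\<^esup>\<close> is represented exactly once.\<close>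

definition parity_check_code :: "'i set \<Rightarrow> 'j set \<Rightarrow> ('i \<Rightarrow> 'j \<Rightarrow> bit) \<Rightarrow> ('j \<Rightarrow> bit) set" where
  "parity_check_code I J M =
    {c. (\<forall>j. j \<notin> J \<longrightarrow> c j = 0) \<and> (\<forall>i\<in>I. (\<Sum>j\<in>J. M i j * c j) = 0)}"

definition hamming_weight :: "('j \<Rightarrow> bit) \<Rightarrow> nat" where
  "hamming_weight c = card {j. c j \<noteq> 0}"

text \<open>The value is \<open>\<infinity>\<close> for the zero code, which has no nonzero codeword.\<close>

definition minimum_distance :: "('j \<Rightarrow> bit) set \<Rightarrow> enat" where
  "minimum_distance C = (INF c \<in> C - {\<lambda>_. 0}. enat (hamming_weight c))"

end

theory Submission imports Defs "HOL-Analysis.L2_Norm"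
begin

text \<open>Let \<open>\<theta>\<close> be the larger root of \<open>x\<^sup>2 - (lam - mu) x - (k - mu)\<close>. Since \<open>M M\<^sup>T = (t + 1) I + N\<close> with
  \<open>N\<close> the adjacency matrix of the point graph, \<open>M M\<^sup>T\<close> has eigenvalue \<open>(s + 1) (t + 1)\<close> on constant
  vectors and at most \<open>t + 1 + \<theta>\<close> on vectors of sum zero. Let \<open>S\<close> be the support of a nonzero
  codeword. Both bounds are Tanner's. For the first, test \<open>M\<close> on the indicator of \<open>S\<close>: every entry
  \<open>m\<close> of the image is an even natural number, so \<open>m\<^sup>2 \<ge> 2 m\<close>. For the second, test \<open>M\<^sup>T\<close> on the
  indicator of the set of points covered by \<open>S\<close>: each such point lies on at least two blocks of
  \<open>S\<close>, and all \<open>s + 1\<close> points of these are covered.\<close>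

section \<open>Centering a function at its mean\<close>

lemma sum_centered:
  fixes f :: "'a \<Rightarrow> real"
  shows "finite X \<Longrightarrow> (\<Sum>x\<in>X. f x - (\<Sum>x\<in>X. f x) / real (card X)) = 0"
  by (cases "X = {}") (simp_all add: sum_subtractf)

lemma sum_centered_squares:
  fixes f :: "'a \<Rightarrow> real"
  assumes "finite X" "X \<noteq> {}" and m: "m = (\<Sum>x\<in>X. f x) / real (card X)"
  shows "(\<Sum>x\<in>X. (f x - m)\<^sup>2) = (\<Sum>x\<in>X. (f x)\<^sup>2) - (\<Sum>x\<in>X. f x)\<^sup>2 / real (card X)"
proof -
  have "(\<Sum>x\<in>X. (f x - m)\<^sup>2) = (\<Sum>x\<in>X. (f x)\<^sup>2 - 2 * m * f x + m\<^sup>2)"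
    by (intro sum.cong refl) (simp add: power2_eq_square algebra_simps)
  also have "\<dots> = (\<Sum>x\<in>X. (f x)\<^sup>2) - 2 * m * (\<Sum>x\<in>X. f x) + real (card X) * m\<^sup>2"
    by (simp add: sum.distrib sum_subtractf sum_distrib_left)
  also have "\<dots> = (\<Sum>x\<in>X. (f x)\<^sup>2) - (\<Sum>x\<in>X. f x)\<^sup>2 / real (card X)"
    using assms by (simp add: m power2_eq_square field_simps)
  finally show ?thesis .
qed

section \<open>The second eigenvalue of a strongly regular graph\<close>

context strongly_regular_graph
begin

text \<open>The adjacency matrix \<open>N\<close> applied to the vector \<open>f\<close>.\<close>

definition nbr_sum :: "('a \<Rightarrow> real) \<Rightarrow> 'a \<Rightarrow> real" where
  "nbr_sum f x = (\<Sum>y | y \<in> V \<and> adj x y. f y)"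

lemma adj_commute: "x \<in> V \<Longrightarrow> y \<in> V \<Longrightarrow> adj x y \<longleftrightarrow> adj y x"
  using adj_sym by (auto simp: symp_on_def)

lemma not_adj_self: "x \<in> V \<Longrightarrow> \<not> adj x x"
  using adj_irrefl by (auto simp: irreflp_on_def)

lemma nbr_sum_of_bool: "nbr_sum f x = (\<Sum>y\<in>V. of_bool (adj x y) * f y)"
proof -
  have "nbr_sum f x = (\<Sum>y\<in>V. if adj x y then f y else 0)"
    unfolding nbr_sum_def using finite_vertices
    by (simp add: sum.inter_filter[symmetric])
  also have "\<dots> = (\<Sum>y\<in>V. of_bool (adj x y) * f y)"
    by (intro sum.cong) auto
  finally show ?thesis .
qed

text \<open>Entrywise form of \<open>N^2 = (k - mu) I + (lam - mu) N + mu J\<close>, where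
  \<open>J\<close> is the all-one matrix.\<close>

lemma card_common_neighbours:
  assumes "x \<in> V" "y \<in> V"
  shows "real (card {z \<in> V. adj x z \<and> adj y z}) =
    (real k - real mu) * of_bool (x = y) + (real lam - real mu) * of_bool (adj x y) + real mu"
proof (cases "x = y")
  case True
  then show ?thesis using regular assms not_adj_self by simp
next
  case False
  then show ?thesis
    using common_adj[OF assms] common_nonadj[OF assms] by (cases "adj x y") auto
qed

text \<open>Since \<open>N\<close> is symmetric, \<open>|N f|^2\<close> is the quadratic form of
  \<open>N^2\<close> at \<open>f\<close>, and \<open>N^2\<close> is a combination of
  \<open>I\<close>, \<open>N\<close> and \<open>J\<close>.\<close>

lemma sum_nbr_sum_squares:
  "(\<Sum>x\<in>V. (nbr_sum f x)\<^sup>2) = (real k - real mu) * (\<Sum>x\<in>V. (f x)\<^sup>2)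
     + (real lam - real mu) * (\<Sum>x\<in>V. f x * nbr_sum f x) + real mu * (\<Sum>x\<in>V. f x)\<^sup>2"
proof -
  let ?a = "\<lambda>x y. of_bool (adj x y) :: real"
  \<comment> \<open>This is the \<open>(y, z)\<close> entry of \<open>N^2\<close>; symmetry of
    \<open>adj\<close> turns it into a number of common neighbours.\<close>
  have count: "(\<Sum>x\<in>V. ?a x y * ?a x z) =
      (real k - real mu) * of_bool (y = z) + (real lam - real mu) * ?a y z + real mu"
    if "y \<in> V" "z \<in> V" for y z
  proof -
    have "(\<Sum>x\<in>V. ?a x y * ?a x z) = (\<Sum>x\<in>V. if adj y x \<and> adj z x then 1 else 0)"
      using that adj_commute by (intro sum.cong) auto
    also have "\<dots> = real (card {x \<in> V. adj y x \<and> adj z x})"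
      using finite_vertices by (simp add: sum.inter_filter[symmetric])
    finally show ?thesis using card_common_neighbours[OF that] by simp
  qed
  have "(\<Sum>x\<in>V. (nbr_sum f x)\<^sup>2) = (\<Sum>x\<in>V. \<Sum>y\<in>V. \<Sum>z\<in>V. f y * f z * (?a x y * ?a x z))"
    unfolding nbr_sum_of_bool power2_eq_square sum_product
    by (intro sum.cong refl) (simp add: mult_ac)
  also have "\<dots> = (\<Sum>y\<in>V. \<Sum>x\<in>V. \<Sum>z\<in>V. f y * f z * (?a x y * ?a x z))"
    by (rule sum.swap)
  also have "\<dots> = (\<Sum>y\<in>V. \<Sum>z\<in>V. \<Sum>x\<in>V. f y * f z * (?a x y * ?a x z))"
    by (rule sum.cong[OF refl], rule sum.swap)
  also have "\<dots> = (\<Sum>y\<in>V. \<Sum>z\<in>V. f y * f z *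
      ((real k - real mu) * of_bool (y = z) + (real lam - real mu) * ?a y z + real mu))"
    by (intro sum.cong refl) (simp only: sum_distrib_left[symmetric] count)
  also have "\<dots> = (\<Sum>y\<in>V. (real k - real mu) * (f y)\<^sup>2 +
      (real lam - real mu) * (f y * nbr_sum f y) + real mu * (f y * (\<Sum>z\<in>V. f z)))"
  proof (intro sum.cong refl)
    fix y assume y: "y \<in> V"
    have "(\<Sum>z\<in>V. f y * f z *
        ((real k - real mu) * of_bool (y = z) + (real lam - real mu) * ?a y z + real mu)) =
      (\<Sum>z\<in>V. if y = z then (real k - real mu) * (f y)\<^sup>2 else 0) +
      (\<Sum>z\<in>V. (real lam - real mu) * f y * (?a y z * f z)) + (\<Sum>z\<in>V. real mu * f y * f z)"
      unfolding sum.distrib[symmetric]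
      by (intro sum.cong refl) (simp add: power2_eq_square algebra_simps)
    also have "\<dots> = (real k - real mu) * (f y)\<^sup>2 +
      (real lam - real mu) * (f y * nbr_sum f y) + real mu * (f y * (\<Sum>z\<in>V. f z))"
      using y finite_vertices
      by (simp add: sum_distrib_left[symmetric] nbr_sum_of_bool)
    finally show "(\<Sum>z\<in>V. f y * f z *
        ((real k - real mu) * of_bool (y = z) + (real lam - real mu) * ?a y z + real mu)) = \<dots>" .
  qed
  also have "\<dots> = (real k - real mu) * (\<Sum>x\<in>V. (f x)\<^sup>2)
     + (real lam - real mu) * (\<Sum>x\<in>V. f x * nbr_sum f x) + real mu * (\<Sum>x\<in>V. f x)\<^sup>2"
    by (simp add: sum.distrib sum_distrib_left[symmetric] sum_distrib_right[symmetric] power2_eq_square)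
  finally show ?thesis .
qed

text \<open>The discriminant of \<open>x^2 - (lam - mu) x - (k - mu)\<close>, the polynomial that
  \<open>N\<close> satisfies on vectors of sum zero.\<close>

definition discr :: real where
  "discr = (real lam - real mu)\<^sup>2 + 4 * (real k - real mu)"

text \<open>For a complete graph, where \<open>mu\<close> is arbitrary, this is only an upper bound for the second
  eigenvalue.\<close>

definition second_eigenvalue :: real where
  "second_eigenvalue = (real lam - real mu + sqrt discr) / 2"

text \<open>On vectors of sum zero the shifted adjacency operator \<open>N - (lam - mu) / 2\<close> is, up to the
  factor \<open>sqrt discr / 2\<close>, an isometry. This replaces the spectral theorem.\<close>

lemma shifted_nbr_sum_squares:
  assumes "(\<Sum>x\<in>V. f x) = 0"
  shows "(\<Sum>x\<in>V. (nbr_sum f x - (real lam - real mu) / 2 * f x)\<^sup>2) = discr / 4 * (\<Sum>x\<in>V. (f x)\<^sup>2)"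
proof -
  define c where "c = (real lam - real mu) / 2"
  have "(\<Sum>x\<in>V. (nbr_sum f x - c * f x)\<^sup>2) =
      (\<Sum>x\<in>V. (nbr_sum f x)\<^sup>2 - 2 * c * (f x * nbr_sum f x) + c\<^sup>2 * (f x)\<^sup>2)"
    by (intro sum.cong refl) (simp add: power2_eq_square algebra_simps)
  also have "\<dots> = (\<Sum>x\<in>V. (nbr_sum f x)\<^sup>2) - 2 * c * (\<Sum>x\<in>V. f x * nbr_sum f x)
      + c\<^sup>2 * (\<Sum>x\<in>V. (f x)\<^sup>2)"
    by (simp only: sum.distrib sum_subtractf sum_distrib_left)
  also have "\<dots> = (real k - real mu) * (\<Sum>x\<in>V. (f x)\<^sup>2) + c\<^sup>2 * (\<Sum>x\<in>V. (f x)\<^sup>2)"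
    using sum_nbr_sum_squares[of f] assms by (simp add: c_def)
  also have "\<dots> = discr / 4 * (\<Sum>x\<in>V. (f x)\<^sup>2)"
    unfolding discr_def c_def by (simp add: power2_eq_square field_simps)
  finally show ?thesis unfolding c_def .
qed

text \<open>A nonzero vector of sum zero, used to read off the sign of a constant from an inequality
  between quadratic forms.\<close>

lemma sum_zero_witness:
  assumes "p \<in> V" "q \<in> V" "p \<noteq> q"
  defines "f \<equiv> \<lambda>x. of_bool (x = p) - of_bool (x = q) :: real"
  shows "(\<Sum>x\<in>V. f x) = 0" "(\<Sum>x\<in>V. (f x)\<^sup>2) > 0"
proof -
  show "(\<Sum>x\<in>V. f x) = 0"
    unfolding f_def using assms finite_vertices by (simp add: sum_subtractf of_bool_def)
  have "f p = 1" unfolding f_def using assms by simp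
  then show "(\<Sum>x\<in>V. (f x)\<^sup>2) > 0"
    using assms finite_vertices by (intro sum_pos2[of V p]) auto
qed

lemma discr_nonneg:
  assumes "p \<in> V" "q \<in> V" "p \<noteq> q"
  shows "discr \<ge> 0"
proof -
  let ?f = "\<lambda>x. of_bool (x = p) - of_bool (x = q) :: real"
  note w = sum_zero_witness[OF assms]
  have "0 \<le> discr / 4 * (\<Sum>x\<in>V. (?f x)\<^sup>2)"
    unfolding shifted_nbr_sum_squares[OF w(1), symmetric] by (intro sum_nonneg) auto
  then show ?thesis using w(2) by (simp add: zero_le_mult_iff)
qed

text \<open>Cauchy-Schwarz for \<open>f\<close> and \<open>(N - c) f\<close> with
  \<open>c = (lam - mu) / 2\<close>; the norm of the second vector is known exactly.\<close>

lemma quadratic_form_le: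
  assumes "(\<Sum>x\<in>V. f x) = 0"
  shows "(\<Sum>x\<in>V. f x * nbr_sum f x) \<le> second_eigenvalue * (\<Sum>x\<in>V. (f x)\<^sup>2)"
proof -
  define c where "c = (real lam - real mu) / 2"
  let ?F = "\<Sum>x\<in>V. (f x)\<^sup>2"
  have F: "?F \<ge> 0" by (intro sum_nonneg) auto
  have "(\<Sum>x\<in>V. f x * nbr_sum f x) - c * ?F = (\<Sum>x\<in>V. f x * (nbr_sum f x - c * f x))"
    by (simp add: sum_distrib_left sum_subtractf[symmetric] algebra_simps power2_eq_square)
  also have "\<dots> \<le> (\<Sum>x\<in>V. \<bar>f x\<bar> * \<bar>nbr_sum f x - c * f x\<bar>)"
    by (intro sum_mono) (metis abs_ge_self abs_mult)
  also have "\<dots> \<le> L2_set f V * L2_set (\<lambda>x. nbr_sum f x - c * f x) V"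
    by (rule L2_set_mult_ineq)
  also have "\<dots> = sqrt ?F * sqrt (discr / 4 * ?F)"
    unfolding L2_set_def c_def shifted_nbr_sum_squares[OF assms] ..
  \<comment> \<open>\<open>sqrt\<close> is extended to negative reals as an odd function, so it is
    multiplicative for either sign of \<open>discr\<close>.\<close>
  also have "\<dots> = sqrt discr / 2 * ?F"
    using F by (simp add: real_sqrt_mult real_sqrt_divide)
  finally show ?thesis unfolding c_def second_eigenvalue_def by (simp add: field_simps)
qed

text \<open>The constant vector is an eigenvector of \<open>N\<close> for \<open>k\<close>;
  evaluating \<open>|N f|^2\<close> there and cancelling \<open>v\<close> gives the
  identity.\<close>

lemma card_mult_mu:
  assumes "V \<noteq> {}"
  shows "real v * real mu = (real k)\<^sup>2 - (real lam - real mu) * real k - (real k - real mu)"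
proof -
  have nb: "nbr_sum (\<lambda>_. 1) x = real k" if "x \<in> V" for x
    unfolding nbr_sum_def using regular[OF that] by simp
  have "real v * (real k)\<^sup>2 = real v * (real k - real mu) + (real lam - real mu) * (real v * real k)
      + real mu * (real v)\<^sup>2"
    using sum_nbr_sum_squares[of "\<lambda>_. 1"] by (simp add: nb card_vertices mult_ac)
  then have "real v * ((real k)\<^sup>2) = real v * ((real k - real mu) + (real lam - real mu) * real k
      + real mu * real v)"
    by (simp add: power2_eq_square algebra_simps)
  moreover have "v > 0" using assms finite_vertices card_vertices by (metis card_gt_0_iff)
  ultimately have "(real k)\<^sup>2 = (real k - real mu) + (real lam - real mu) * real k + real mu * real v"
    by simp
  then show ?thesis by (simp add: algebra_simps)
qed

text \<open>By \<open>card_mult_mu\<close> the quadratic with discriminant \<open>discr\<close>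
  takes the value \<open>v * mu > 0\<close> at \<open>k\<close>. As \<open>k\<close> lies to the
  right of the midpoint \<open>?c\<close> of the roots, it exceeds the larger root.\<close>

lemma second_eigenvalue_less:
  assumes "x \<in> V" "y \<in> V" "adj x y" "mu \<noteq> 0"
  shows "second_eigenvalue < real k"
proof -
  let ?c = "(real lam - real mu) / 2"
  have ne: "x \<noteq> y" using not_adj_self assms by auto
  \<comment> \<open>The common neighbours of the adjacent pair are among the neighbours of
    \<open>x\<close>.\<close>
  have "lam \<le> k"
    unfolding common_adj[OF assms(1-3), symmetric] regular[OF assms(1), symmetric]
    using finite_vertices by (intro card_mono) auto
  then have "real lam \<le> real k" "real mu > 0" using assms(4) by auto
  then have c: "?c < real k" by (simp add: field_simps)
  have "v > 0" using assms finite_vertices card_vertices by (metis card_gt_0_iff empty_iff)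
  then have "real v * real mu > 0" using assms by simp
  moreover have "(real k - ?c)\<^sup>2 = real v * real mu + discr / 4"
  proof -
    have "V \<noteq> {}" using assms(1) by blast
    from card_mult_mu[OF this] show ?thesis by (simp add: discr_def power2_eq_square field_simps)
  qed
  ultimately have "sqrt (discr / 4) < sqrt ((real k - ?c)\<^sup>2)" by simp
  also have "\<dots> = real k - ?c" using c by simp
  finally show ?thesis
    by (simp add: real_sqrt_divide second_eigenvalue_def field_simps)
qed

end

section \<open>Double counting in the geometry\<close>

context generalized_partial_geometry
begin

lemma finite_blocks: "finite \<B>"
  using blocks_subset finite_points by (meson finite_Pow_iff finite_subset Pow_iff subsetI)

lemma finite_block: "b \<in> \<B> \<Longrightarrow> finite b"
  using blocks_subset finite_points finite_subset by blast

text \<open>Two orders of summation over incident pairs. For \<open>g b p = y b * f p\<close> this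
  says that \<open>M\<close> and \<open>M^T\<close> are adjoint.\<close>

lemma sum_over_flags:
  "(\<Sum>b\<in>\<B>. \<Sum>p\<in>b. g b p) = (\<Sum>p\<in>\<P>. \<Sum>b | b \<in> \<B> \<and> p \<in> b. (g b p :: real))"
proof -
  have "(\<Sum>b\<in>\<B>. \<Sum>p\<in>b. g b p) = (\<Sum>b\<in>\<B>. \<Sum>p | p \<in> \<P> \<and> p \<in> b. g b p)"
    by (intro sum.cong) (use blocks_subset in auto)
  also have "\<dots> = (\<Sum>p\<in>\<P>. \<Sum>b | b \<in> \<B> \<and> p \<in> b. g b p)"
    using finite_blocks finite_points by (rule sum.swap_restrict)
  finally show ?thesis .
qed

lemma sum_block_sums: "(\<Sum>b\<in>\<B>. \<Sum>p\<in>b. f p) = (real t + 1) * (\<Sum>p\<in>\<P>. f p)"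
  unfolding sum_over_flags using blocks_on_point by (simp add: sum_distrib_left add.commute)

lemma card_blocks: "real (card \<B>) * (real s + 1) = real (card \<P>) * (real t + 1)"
  using sum_block_sums[of "\<lambda>_. 1"] points_on_block by (simp add: algebra_simps)

text \<open>The entries of \<open>M M^T = (t + 1) I + N\<close>: off the diagonal they are 0 or 1,
  because two points share at most one block.\<close>

lemma card_common_blocks:
  assumes "p \<in> \<P>" "q \<in> \<P>"
  shows "real (card {b \<in> \<B>. p \<in> b \<and> q \<in> b}) =
    (real t + 1) * of_bool (p = q) + of_bool (point_adj \<B> p q)"
proof (cases "p = q")
  case True
  then show ?thesis using blocks_on_point assms by (simp add: point_adj_def)
next
  case False
  show ?thesis
  proof (cases "\<exists>b\<in>\<B>. p \<in> b \<and> q \<in> b")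
    case True
    then obtain b where b: "b \<in> \<B>" "p \<in> b" "q \<in> b" by blast
    then have "{b \<in> \<B>. p \<in> b \<and> q \<in> b} = {b}"
      using at_most_one_block[OF assms False] by (auto simp: Uniq_def)
    then show ?thesis using b False by (auto simp: point_adj_def joined_def)
  next
    case no: False
    then have "{b \<in> \<B>. p \<in> b \<and> q \<in> b} = {}" by blast
    moreover have "\<not> point_adj \<B> p q" using no by (auto simp: point_adj_def joined_def)
    ultimately show ?thesis using False by (simp only: card.empty) simp
  qed
qed

end

section \<open>Bounds for the two Gram matrices of the incidence matrix\<close>

context srpg
begin

text \<open>The squared norm of \<open>M^T f\<close>, expanded through
  \<open>M M^T = (t + 1) I + N\<close>.\<close>

lemma sum_block_squares:
  "(\<Sum>b\<in>\<B>. (\<Sum>p\<in>b. f p)\<^sup>2) =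
    (real t + 1) * (\<Sum>p\<in>\<P>. (f p)\<^sup>2) + (\<Sum>p\<in>\<P>. f p * nbr_sum f p)"
proof -
  have "(\<Sum>b\<in>\<B>. (\<Sum>p\<in>b. f p)\<^sup>2) = (\<Sum>b\<in>\<B>. \<Sum>p\<in>b. \<Sum>q\<in>b. f p * f q)"
    by (simp add: power2_eq_square sum_product)
  also have "\<dots> = (\<Sum>p\<in>\<P>. \<Sum>b | b \<in> \<B> \<and> p \<in> b. \<Sum>q\<in>b. f p * f q)"
    by (rule sum_over_flags)
  also have "\<dots> = (\<Sum>p\<in>\<P>. (real t + 1) * (f p)\<^sup>2 + f p * nbr_sum f p)"
  proof (intro sum.cong refl)
    fix p assume p: "p \<in> \<P>"
    have "(\<Sum>b | b \<in> \<B> \<and> p \<in> b. \<Sum>q\<in>b. f p * f q) =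
        (\<Sum>b | b \<in> \<B> \<and> p \<in> b. \<Sum>q | q \<in> \<P> \<and> q \<in> b. f p * f q)"
      by (intro sum.cong) (use blocks_subset in auto)
    \<comment> \<open>After the swap the coefficient of \<open>f p * f q\<close> is the number of
      blocks on both points.\<close>
    also have "\<dots> = (\<Sum>q\<in>\<P>. \<Sum>b | b \<in> {b \<in> \<B>. p \<in> b} \<and> q \<in> b. f p * f q)"
      using finite_blocks finite_points
        sum.swap_restrict[of "{b \<in> \<B>. p \<in> b}" \<P> "\<lambda>b q. f p * f q" "\<lambda>b q. q \<in> b"] by simp
    also have "\<dots> = (\<Sum>q\<in>\<P>. real (card {b \<in> \<B>. p \<in> b \<and> q \<in> b}) * (f p * f q))"
      by simp
    also have "\<dots> = (\<Sum>q\<in>\<P>. (if p = q then (real t + 1) * (f p)\<^sup>2 else 0)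
        + f p * (of_bool (point_adj \<B> p q) * f q))"
      by (intro sum.cong refl)
        (use p in \<open>simp add: card_common_blocks power2_eq_square algebra_simps\<close>)
    also have "\<dots> = (real t + 1) * (f p)\<^sup>2 + f p * nbr_sum f p"
      using p finite_points by (simp add: sum.distrib sum_distrib_left[symmetric] nbr_sum_of_bool)
    finally show "(\<Sum>b | b \<in> \<B> \<and> p \<in> b. \<Sum>q\<in>b. f p * f q) = \<dots>" .
  qed
  also have "\<dots> = (real t + 1) * (\<Sum>p\<in>\<P>. (f p)\<^sup>2) + (\<Sum>p\<in>\<P>. f p * nbr_sum f p)"
    by (simp add: sum.distrib sum_distrib_left)
  finally show ?thesis .
qed

abbreviation gram_eigenvalue :: real where
  "gram_eigenvalue \<equiv> real t + 1 + second_eigenvalue"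

lemma sum_block_squares_le:
  assumes "(\<Sum>p\<in>\<P>. f p) = 0"
  shows "(\<Sum>b\<in>\<B>. (\<Sum>p\<in>b. f p)\<^sup>2) \<le> gram_eigenvalue * (\<Sum>p\<in>\<P>. (f p)\<^sup>2)"
  using quadratic_form_le[OF assms] unfolding sum_block_squares by (simp add: algebra_simps)

text \<open>\<open>M M^T\<close> is positive semidefinite, and two distinct points provide a nonzero
  vector of sum zero.\<close>

lemma gram_eigenvalue_nonneg:
  assumes "p \<in> \<P>" "q \<in> \<P>" "p \<noteq> q"
  shows "gram_eigenvalue \<ge> 0"
proof -
  let ?f = "\<lambda>x. of_bool (x = p) - of_bool (x = q) :: real"
  note w = sum_zero_witness[OF assms]
  have "0 \<le> (\<Sum>b\<in>\<B>. (\<Sum>p\<in>b. ?f p)\<^sup>2)" by (intro sum_nonneg) auto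
  also note sum_block_squares_le[OF w(1)]
  finally show ?thesis using w(2) by (metis zero_le_mult_iff not_less)
qed

text \<open>Split \<open>f\<close> into its mean and a part of sum zero; the cross term vanishes.
  The constant part has eigenvalue \<open>(s + 1) * (t + 1)\<close>, which exceeds
  \<open>gram_eigenvalue\<close> by \<open>s * (t + 1) - second_eigenvalue\<close>.\<close>

lemma sum_block_squares_bound:
  "(\<Sum>b\<in>\<B>. (\<Sum>p\<in>b. f p)\<^sup>2) \<le> gram_eigenvalue * (\<Sum>p\<in>\<P>. (f p)\<^sup>2)
     + (real s * (real t + 1) - second_eigenvalue) * (\<Sum>p\<in>\<P>. f p)\<^sup>2 / real (card \<P>)"
proof -
  define m where "m = (\<Sum>p\<in>\<P>. f p) / real (card \<P>)"
  define f0 where "f0 = (\<lambda>p. f p - m)"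
  have v: "real (card \<P>) > 0" using finite_points points_nonempty by (simp add: card_gt_0_iff)
  have f0_sum: "(\<Sum>p\<in>\<P>. f0 p) = 0"
    unfolding f0_def m_def by (rule sum_centered[OF finite_points])
  have f0_sq: "(\<Sum>p\<in>\<P>. (f0 p)\<^sup>2) = (\<Sum>p\<in>\<P>. (f p)\<^sup>2) - (\<Sum>p\<in>\<P>. f p)\<^sup>2 / real (card \<P>)"
    unfolding f0_def by (rule sum_centered_squares[OF finite_points points_nonempty m_def])
  have "(\<Sum>b\<in>\<B>. (\<Sum>p\<in>b. f p)\<^sup>2) =
      (\<Sum>b\<in>\<B>. (\<Sum>p\<in>b. f0 p)\<^sup>2 + 2 * m * (real s + 1) * (\<Sum>p\<in>b. f0 p) + (m * (real s + 1))\<^sup>2)"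
  proof (intro sum.cong refl)
    fix b assume "b \<in> \<B>"
    then have "(\<Sum>p\<in>b. f p) = (\<Sum>p\<in>b. f0 p) + m * (real s + 1)"
      using points_on_block by (simp add: f0_def sum_subtractf algebra_simps)
    then show "(\<Sum>p\<in>b. f p)\<^sup>2 =
        (\<Sum>p\<in>b. f0 p)\<^sup>2 + 2 * m * (real s + 1) * (\<Sum>p\<in>b. f0 p) + (m * (real s + 1))\<^sup>2"
      by (simp add: power2_eq_square algebra_simps)
  qed
  also have "\<dots> = (\<Sum>b\<in>\<B>. (\<Sum>p\<in>b. f0 p)\<^sup>2) + 2 * m * (real s + 1) * (\<Sum>b\<in>\<B>. \<Sum>p\<in>b. f0 p)
      + real (card \<B>) * (m * (real s + 1))\<^sup>2"
    by (simp add: sum.distrib sum_distrib_left)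
  also have "(\<Sum>b\<in>\<B>. \<Sum>p\<in>b. f0 p) = 0"
    unfolding sum_block_sums f0_sum by simp
  also have "real (card \<B>) * (m * (real s + 1))\<^sup>2
      = (real (card \<B>) * (real s + 1)) * m\<^sup>2 * (real s + 1)"
    by (simp add: power2_eq_square)
  also have "\<dots> = (real s + 1) * (real t + 1) * ((\<Sum>p\<in>\<P>. f p)\<^sup>2 / real (card \<P>))"
    unfolding card_blocks m_def using v by (simp add: power2_eq_square field_simps)
  finally show ?thesis
    using sum_block_squares_le[OF f0_sum] unfolding f0_sq
    by (simp add: algebra_simps add_divide_distrib diff_divide_distrib)
qed

text \<open>The nonzero eigenvalues of the two Gram matrices \<open>M M\<^sup>T\<close> and \<open>M\<^sup>T M\<close> agree, so the bound
  on point vectors transfers to block vectors by duality.\<close>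

lemma sum_point_squares_le:
  assumes zero: "(\<Sum>b\<in>\<B>. y b) = 0" and nonneg: "gram_eigenvalue \<ge> 0"
  shows "(\<Sum>p\<in>\<P>. (\<Sum>b | b \<in> \<B> \<and> p \<in> b. y b)\<^sup>2) \<le> gram_eigenvalue * (\<Sum>b\<in>\<B>. (y b)\<^sup>2)"
proof -
  define w where "w = (\<lambda>p. \<Sum>b | b \<in> \<B> \<and> p \<in> b. y b)"
  let ?W = "\<Sum>p\<in>\<P>. (w p)\<^sup>2" and ?Y = "\<Sum>b\<in>\<B>. (y b)\<^sup>2"
  have Y: "?Y \<ge> 0" by (intro sum_nonneg) auto
  have "(\<Sum>p\<in>\<P>. w p) = (\<Sum>b\<in>\<B>. \<Sum>p\<in>b. y b)"
    unfolding w_def sum_over_flags ..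
  also have "\<dots> = (real s + 1) * (\<Sum>b\<in>\<B>. y b)"
    using points_on_block by (simp add: sum_distrib_left add.commute)
  finally have w_sum: "(\<Sum>p\<in>\<P>. w p) = 0" using zero by simp
  \<comment> \<open>With \<open>w = M y\<close>, \<open>|w|^2\<close> is the inner product of
    \<open>y\<close> and \<open>M^T w\<close>. Cauchy-Schwarz and the bound on \<open>M^T w\<close>
    leave one factor \<open>|w|\<close> to cancel.\<close>
  have "?W = (\<Sum>p\<in>\<P>. \<Sum>b | b \<in> \<B> \<and> p \<in> b. y b * w p)"
    by (simp add: w_def power2_eq_square sum_distrib_right)
  also have "\<dots> = (\<Sum>b\<in>\<B>. y b * (\<Sum>p\<in>b. w p))"
    unfolding sum_over_flags[symmetric] by (simp add: sum_distrib_left)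
  also have "\<dots> \<le> (\<Sum>b\<in>\<B>. \<bar>y b\<bar> * \<bar>\<Sum>p\<in>b. w p\<bar>)"
    by (intro sum_mono) (metis abs_ge_self abs_mult)
  also have "\<dots> \<le> L2_set y \<B> * L2_set (\<lambda>b. \<Sum>p\<in>b. w p) \<B>"
    by (rule L2_set_mult_ineq)
  also have "\<dots> \<le> sqrt ?Y * sqrt (gram_eigenvalue * ?W)"
    unfolding L2_set_def
    by (intro mult_left_mono real_sqrt_le_mono sum_block_squares_le w_sum) (simp add: Y)
  also have "\<dots> = sqrt (gram_eigenvalue * ?Y) * sqrt ?W"
    by (simp add: real_sqrt_mult)
  finally have le: "sqrt ?W * sqrt ?W \<le> sqrt (gram_eigenvalue * ?Y) * sqrt ?W"
    by (simp add: sum_nonneg)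
  show ?thesis
  proof (cases "?W = 0")
    \<comment> \<open>Nothing can be cancelled here; the claim is that the right-hand side is
      nonnegative.\<close>
    case True
    then show ?thesis using nonneg Y by (simp add: w_def)
  next
    case False
    moreover have "?W \<ge> 0" by (intro sum_nonneg) auto
    ultimately have "sqrt ?W > 0" by simp
    with le have "sqrt ?W \<le> sqrt (gram_eigenvalue * ?Y)" by (simp only: mult_le_cancel_right_pos)
    then show ?thesis by (simp add: w_def)
  qed
qed

end

section \<open>Even sets of blocks and the two lower bounds on their size\<close>

text \<open>The support \<open>S\<close> of a nonzero codeword: a nonempty set of blocks covering each point an even
  number of times.\<close>

locale even_block_set = srpg +
  fixes S
  assumes S_subset: "S \<subseteq> \<B>" and S_nonempty: "S \<noteq> {}"
    and even_cover: "\<And>p. p \<in> \<P> \<Longrightarrow> even (card {b \<in> S. p \<in> b})"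
begin

lemma finite_S: "finite S"
  using S_subset finite_blocks finite_subset by blast

text \<open>On points, this is \<open>M\<close> applied to the indicator of
  \<open>S\<close>.\<close>

definition cover :: "'a \<Rightarrow> real" where
  "cover p = real (card {b \<in> S. p \<in> b})"

text \<open>A positive even number is at least 2. Both bounds use the parity of the cover only
  through this fact.\<close>

lemma cover_ge_2:
  assumes "b \<in> S" "p \<in> b"
  shows "cover p \<ge> 2"
proof -
  have "p \<in> \<P>" using assms S_subset blocks_subset by blast
  then have "even (card {b \<in> S. p \<in> b})" by (rule even_cover)
  moreover have "card {b \<in> S. p \<in> b} \<noteq> 0" using assms finite_S by auto
  ultimately have "card {b \<in> S. p \<in> b} \<ge> 2" by presburger
  then show ?thesis unfolding cover_def by linarith
qed

text \<open>A point of a block in \<open>S\<close> lies on a second block of \<open>S\<close>. Two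
  distinct blocks through \<open>p\<close> cannot both be \<open>{p}\<close>, so one of them has a
  further point; this excludes \<open>s = 0\<close>.\<close>

lemma obtain_adjacent:
  obtains p q where "p \<in> \<P>" "q \<in> \<P>" "point_adj \<B> p q"
proof -
  obtain b where b: "b \<in> S" using S_nonempty by blast
  then have bB: "b \<in> \<B>" using S_subset by blast
  obtain p where p: "p \<in> b" using points_on_block[OF bB] by fastforce
  have "\<not> {b' \<in> S. p \<in> b'} \<subseteq> {b}"
  proof
    assume "{b' \<in> S. p \<in> b'} \<subseteq> {b}"
    then have "card {b' \<in> S. p \<in> b'} \<le> 1" using card_mono[of "{b}"] by fastforce
    then show False using cover_ge_2[OF b p] unfolding cover_def by simp
  qed
  then obtain b' where b': "b' \<in> S" "p \<in> b'" "b' \<noteq> b" by blast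
  have "\<not> (b \<subseteq> {p} \<and> b' \<subseteq> {p})" using b' p by blast
  then obtain c q where "c \<in> \<B>" "p \<in> c" "q \<in> c" "q \<noteq> p" using b' bB p S_subset by blast
  then show ?thesis
    by (intro that[of p q]) (use blocks_subset in \<open>auto simp: point_adj_def joined_def\<close>)
qed

text \<open>Makes the denominators of both bounds positive.\<close>

lemma gap_pos: "real s * (real t + 1) - second_eigenvalue > 0"
proof -
  obtain p q where "p \<in> \<P>" "q \<in> \<P>" "point_adj \<B> p q" by (rule obtain_adjacent)
  from second_eigenvalue_less[OF this mu_nonzero] show ?thesis by (simp add: algebra_simps)
qed

lemma card_blocks_pos: "real (card \<B>) > 0"
  using S_subset S_nonempty finite_blocks by (auto simp: card_gt_0_iff)

lemma card_blocks_eq: "real (card \<P>) * (real t + 1) / (real s + 1) = real (card \<B>)"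
  using card_blocks by (simp add: field_simps)

lemma sum_cover: "(\<Sum>p\<in>\<P>. cover p) = (real s + 1) * real (card S)"
proof -
  have "(\<Sum>p\<in>\<P>. cover p) = (\<Sum>p\<in>\<P>. \<Sum>b | b \<in> S \<and> p \<in> b. 1)"
    by (simp add: cover_def)
  also have "\<dots> = (\<Sum>b\<in>S. \<Sum>p | p \<in> \<P> \<and> p \<in> b. 1)"
    using finite_points finite_S by (rule sum.swap_restrict)
  also have "\<dots> = (\<Sum>b\<in>S. real s + 1)"
  proof (intro sum.cong refl)
    fix b assume "b \<in> S"
    then have "b \<in> \<B>" using S_subset by blast
    moreover from this have "{p. p \<in> \<P> \<and> p \<in> b} = b" using blocks_subset by blast
    ultimately show "(\<Sum>p | p \<in> \<P> \<and> p \<in> b. 1) = real s + 1" using points_on_block by simp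
  qed
  finally show ?thesis by simp
qed

text \<open>The bit-oriented bound with its denominator cleared: the mean of the indicator of
  \<open>S\<close> is removed, and the dual Gram bound is applied to the rest.\<close>

lemma bit_bound:
  "real (card \<B>) * (2 * real s + 1 - real t - second_eigenvalue)
    \<le> real (card S) * (real s * (real t + 1) - second_eigenvalue)"
proof -
  define d where "d = real (card S)"
  define n where "n = real (card \<B>)"
  have d: "d > 0" unfolding d_def using finite_S S_nonempty by (simp add: card_gt_0_iff)
  have n: "n > 0" unfolding n_def by (rule card_blocks_pos)
  define c :: "'a set \<Rightarrow> real" where "c b = of_bool (b \<in> S)" for b
  define y where "y b = c b - d / n" for b
  have c_sum: "(\<Sum>b\<in>\<B>. c b) = d"
    using S_subset finite_blocks by (simp add: c_def d_def of_bool_def sum.If_cases Int_absorb1 Int_def[symmetric])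
  have c_sq: "(\<Sum>b\<in>\<B>. (c b)\<^sup>2) = d"
    unfolding c_sum[symmetric] by (intro sum.cong refl) (simp add: c_def)
  have y_sum: "(\<Sum>b\<in>\<B>. y b) = 0"
    unfolding y_def n_def c_sum[symmetric] by (rule sum_centered[OF finite_blocks])
  have y_sq: "(\<Sum>b\<in>\<B>. (y b)\<^sup>2) = d - d\<^sup>2 / n"
  proof -
    have "\<B> \<noteq> {}" using S_subset S_nonempty by blast
    then show ?thesis
      unfolding y_def using sum_centered_squares[OF finite_blocks, of "d / n" c]
      by (simp add: c_sum c_sq n_def)
  qed
  have y_pt: "(\<Sum>b | b \<in> \<B> \<and> p \<in> b. y b) = cover p - (real t + 1) * (d / n)" if "p \<in> \<P>" for p
  proof -
    have "(\<Sum>b | b \<in> \<B> \<and> p \<in> b. c b) = cover p"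
    proof -
      have "{b. b \<in> \<B> \<and> p \<in> b} \<inter> S = {b \<in> S. p \<in> b}" using S_subset by blast
      then show ?thesis using finite_blocks
        by (simp add: c_def cover_def of_bool_def sum.If_cases Int_def[symmetric])
    qed
    then show ?thesis using blocks_on_point[OF that] by (simp add: y_def sum_subtractf)
  qed
  \<comment> \<open>Subtracting the mean \<open>d / n\<close> from the indicator subtracts exactly
    the mean from \<open>cover\<close>, so the image of \<open>y\<close> is \<open>cover\<close>
    centered.\<close>
  have mean: "(real t + 1) * (d / n) = (\<Sum>p\<in>\<P>. cover p) / real (card \<P>)"
  proof -
    have "real (card \<P>) > 0" using finite_points points_nonempty by (simp add: card_gt_0_iff)
    moreover have "(real t + 1) * d * real (card \<P>) = (real s + 1) * d * n"
      using card_blocks unfolding n_def by algebra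
    ultimately show ?thesis unfolding sum_cover d_def[symmetric] using n
      by (simp add: frac_eq_eq)
  qed
  have "gram_eigenvalue \<ge> 0"
  proof -
    obtain p q where pq: "p \<in> \<P>" "q \<in> \<P>" "point_adj \<B> p q" by (rule obtain_adjacent)
    then show ?thesis by (intro gram_eigenvalue_nonneg[of p q]) (auto simp: point_adj_def)
  qed
  from sum_point_squares_le[OF y_sum this]
  have "(\<Sum>p\<in>\<P>. (cover p - (real t + 1) * (d / n))\<^sup>2) \<le> gram_eigenvalue * (d - d\<^sup>2 / n)"
    by (simp add: y_pt y_sq)
  then have up: "(\<Sum>p\<in>\<P>. (cover p)\<^sup>2) - (real t + 1) * (d / n) * ((real s + 1) * d)
      \<le> gram_eigenvalue * (d - d\<^sup>2 / n)"
    using sum_centered_squares[OF finite_points points_nonempty mean]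
    unfolding mean by (simp add: sum_cover d_def power2_eq_square)
  \<comment> \<open>Each value of \<open>cover\<close> is 0 or at least 2.\<close>
  have "2 * (\<Sum>p\<in>\<P>. cover p) \<le> (\<Sum>p\<in>\<P>. (cover p)\<^sup>2)"
    unfolding sum_distrib_left
  proof (rule sum_mono)
    fix p
    show "2 * cover p \<le> (cover p)\<^sup>2" if "p \<in> \<P>"
    proof (cases "{b \<in> S. p \<in> b} = {}")
      case True
      then show ?thesis by (simp only: cover_def card.empty) simp
    next
      case False
      then have "cover p \<ge> 2" using cover_ge_2 by blast
      then show ?thesis by (simp add: power2_eq_square mult_right_mono)
    qed
  qed
  then have "2 * (real s + 1) * d \<le> (real t + 1) * (d / n) * ((real s + 1) * d)
      + gram_eigenvalue * (d - d\<^sup>2 / n)"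
    using up unfolding sum_cover d_def by linarith
  \<comment> \<open>The coefficient of \<open>d / n\<close> is
    \<open>(s + 1) * (t + 1) - gram_eigenvalue\<close>.\<close>
  also have "\<dots> = d * ((real s * (real t + 1) - second_eigenvalue) * d / n + gram_eigenvalue)"
    using n by (simp add: power2_eq_square field_simps)
  finally have "2 * (real s + 1) \<le> (real s * (real t + 1) - second_eigenvalue) * d / n + gram_eigenvalue"
    using d by (metis mult.commute mult_le_cancel_left_pos)
  then show ?thesis
    unfolding d_def[symmetric] n_def[symmetric] using n by (simp add: field_simps)
qed

text \<open>The parity-oriented bound with its denominator cleared. The Gram bound at the indicator
  \<open>u\<close> of the covered points \<open>T\<close> bounds \<open>card T\<close> from below,
  and counting flags gives \<open>2 * card T \<le> (s + 1) * card S\<close>.\<close>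

lemma parity_bound:
  "2 * real (card \<B>) * (2 * real s - second_eigenvalue)
    \<le> real (card S) * ((real t + 1) * (real s * (real t + 1) - second_eigenvalue))"
proof -
  define T where "T = \<Union>S"
  define u :: "'a \<Rightarrow> real" where "u p = of_bool (p \<in> T)" for p
  let ?gap = "real s * (real t + 1) - second_eigenvalue"
  have T_sub: "T \<subseteq> \<P>" unfolding T_def using S_subset blocks_subset by blast
  have finT: "finite T" using T_sub finite_points finite_subset by blast
  have T_pos: "real (card T) > 0"
  proof -
    obtain b where "b \<in> S" using S_nonempty by blast
    moreover from this have "b \<noteq> {}" using S_subset points_on_block by fastforce
    ultimately have "T \<noteq> {}" unfolding T_def by blast
    then show ?thesis using finT by (simp add: card_gt_0_iff)
  qed
  have v: "real (card \<P>) > 0" using finite_points points_nonempty by (simp add: card_gt_0_iff)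
  have u_sum: "(\<Sum>p\<in>\<P>. u p) = real (card T)"
    using T_sub finite_points by (simp add: u_def of_bool_def sum.If_cases Int_absorb1 Int_def[symmetric])
  have u_sq: "(\<Sum>p\<in>\<P>. (u p)\<^sup>2) = real (card T)"
    unfolding u_sum[symmetric] by (intro sum.cong refl) (simp add: u_def)
  have u_block: "(\<Sum>p\<in>b. u p) = real (card (b \<inter> T))" if "b \<in> \<B>" for b
    using finite_block[OF that] by (simp add: u_def of_bool_def sum.If_cases Int_def[symmetric])
  \<comment> \<open>The left side is the entry of \<open>M M^T u\<close> at \<open>p\<close>. Each
    of the \<open>t + 1\<close> blocks on \<open>p\<close> meets \<open>T\<close> at least in
    \<open>p\<close>, and those in \<open>S\<close>, at least two, contribute \<open>s\<close>
    further points each.\<close>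
  have deg: "(\<Sum>b | b \<in> \<B> \<and> p \<in> b. \<Sum>q\<in>b. u q) \<ge> 2 * real s + real t + 1" if "p \<in> T" for p
  proof -
    have p: "p \<in> \<P>" using that T_sub by blast
    have fin: "finite {b. b \<in> \<B> \<and> p \<in> b}" using finite_blocks by simp
    have S_cap: "{b. b \<in> \<B> \<and> p \<in> b} \<inter> S = {b \<in> S. p \<in> b}" using S_subset by blast
    have "(\<Sum>b | b \<in> \<B> \<and> p \<in> b. 1 + real s * of_bool (b \<in> S)) = real t + 1 + real s * cover p"
      using blocks_on_point[OF p] fin S_cap
      by (simp add: sum.distrib sum_distrib_left[symmetric] of_bool_def sum.If_cases
          Int_def[symmetric] cover_def)
    moreover have "(\<Sum>b | b \<in> \<B> \<and> p \<in> b. 1 + real s * of_bool (b \<in> S))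
        \<le> (\<Sum>b | b \<in> \<B> \<and> p \<in> b. \<Sum>q\<in>b. u q)"
    proof (rule sum_mono)
      fix b assume "b \<in> {b. b \<in> \<B> \<and> p \<in> b}"
      then have b: "b \<in> \<B>" "p \<in> b" by auto
      show "1 + real s * of_bool (b \<in> S) \<le> (\<Sum>q\<in>b. u q)"
      proof (cases "b \<in> S")
        case True
        then have "b \<inter> T = b" unfolding T_def by blast
        then show ?thesis using True points_on_block[OF b(1)] u_block[OF b(1)] by simp
      next
        case False
        have "card (b \<inter> T) \<noteq> 0" using b that finT by auto
        then show ?thesis using False u_block[OF b(1)] by simp
      qed
    qed
    moreover have "cover p \<ge> 2" using that cover_ge_2 unfolding T_def by blast
    then have "real s * 2 \<le> real s * cover p" by (intro mult_left_mono) auto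
    ultimately show ?thesis by linarith
  qed
  have "real (card T) * (2 * real s + real t + 1) = (\<Sum>p\<in>T. 2 * real s + real t + 1)" by simp
  also have "\<dots> \<le> (\<Sum>p\<in>T. \<Sum>b | b \<in> \<B> \<and> p \<in> b. \<Sum>q\<in>b. u q)"
    by (intro sum_mono deg)
  \<comment> \<open>The factor \<open>u p\<close> is 1 on \<open>T\<close> and 0 elsewhere, so the
    sum extends to all points and becomes \<open>|M^T u|^2\<close>.\<close>
  also have "\<dots> = (\<Sum>p\<in>T. \<Sum>b | b \<in> \<B> \<and> p \<in> b. u p * (\<Sum>q\<in>b. u q))"
    by (intro sum.cong refl) (simp add: u_def)
  also have "\<dots> = (\<Sum>p\<in>\<P>. \<Sum>b | b \<in> \<B> \<and> p \<in> b. u p * (\<Sum>q\<in>b. u q))"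
    by (intro sum.mono_neutral_left finite_points T_sub) (simp add: u_def)
  also have "\<dots> = (\<Sum>b\<in>\<B>. (\<Sum>p\<in>b. u p)\<^sup>2)"
    unfolding sum_over_flags[symmetric] by (simp add: power2_eq_square sum_distrib_right)
  also have "\<dots> \<le> gram_eigenvalue * real (card T) + ?gap * (real (card T))\<^sup>2 / real (card \<P>)"
    using sum_block_squares_bound[of u] unfolding u_sum u_sq .
  also have "\<dots> = real (card T) * (gram_eigenvalue + ?gap * real (card T) / real (card \<P>))"
    by (simp add: power2_eq_square algebra_simps)
  finally have "2 * real s + real t + 1 \<le> gram_eigenvalue + ?gap * real (card T) / real (card \<P>)"
    using T_pos by (metis mult_le_cancel_left_pos)
  then have 1: "(2 * real s - second_eigenvalue) * real (card \<P>) \<le> ?gap * real (card T)"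
    using v by (simp add: field_simps)
  have "2 * real (card T) = (\<Sum>p\<in>T. 2)" by simp
  also have "\<dots> \<le> (\<Sum>p\<in>T. cover p)"
    by (intro sum_mono) (use cover_ge_2 in \<open>auto simp: T_def\<close>)
  also have "\<dots> \<le> (\<Sum>p\<in>\<P>. cover p)"
    using T_sub finite_points by (intro sum_mono2) (auto simp: cover_def)
  finally have 2: "2 * real (card T) \<le> (real s + 1) * real (card S)" unfolding sum_cover .
  \<comment> \<open>The factor \<open>s + 1\<close> turns the number of blocks into the number of
    points through \<open>card_blocks\<close>; it is cancelled at the end.\<close>
  have "(real s + 1) * (2 * real (card \<B>) * (2 * real s - second_eigenvalue)) =
      2 * (real t + 1) * ((2 * real s - second_eigenvalue) * real (card \<P>))"
    using card_blocks by algebra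
  also have "\<dots> \<le> 2 * (real t + 1) * (?gap * real (card T))"
    using 1 by (intro mult_left_mono) auto
  also have "\<dots> = (real t + 1) * ?gap * (2 * real (card T))" by simp
  also have "\<dots> \<le> (real t + 1) * ?gap * ((real s + 1) * real (card S))"
    using 2 gap_pos by (intro mult_left_mono) auto
  also have "\<dots> = (real s + 1) * (real (card S) * ((real t + 1) * ?gap))" by simp
  finally show ?thesis by (simp only: mult_le_cancel_left_pos[of "real s + 1"])
qed

end

section \<open>From codewords to the minimum distance\<close>

lemma of_nat_bit_eq_0_iff: "(of_nat m :: bit) = 0 \<longleftrightarrow> even m"
  by (induction m) auto

text \<open>Row \<open>p\<close> of the parity check, read over the two-element field, is the number
  of support blocks on \<open>p\<close> modulo 2.\<close>

lemma even_support_cover: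
  assumes "finite \<B>" and c: "c \<in> parity_check_code \<P> \<B> incidence_matrix" and p: "p \<in> \<P>"
  shows "even (card {b \<in> {b. c b \<noteq> 0}. p \<in> b})"
proof -
  have supp: "{b \<in> {b. c b \<noteq> 0}. p \<in> b} = {b \<in> \<B>. p \<in> b \<and> c b \<noteq> 0}"
    using c by (auto simp: parity_check_code_def)
  have "(\<Sum>b\<in>\<B>. incidence_matrix p b * c b) = (\<Sum>b\<in>\<B>. if p \<in> b \<and> c b \<noteq> 0 then 1 else 0)"
    by (intro sum.cong refl) (auto simp: incidence_matrix_def)
  also have "\<dots> = of_nat (card {b \<in> \<B>. p \<in> b \<and> c b \<noteq> 0})"
    using assms(1) by (simp add: sum.inter_filter[symmetric])
  also have "(\<Sum>b\<in>\<B>. incidence_matrix p b * c b) = 0"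
    using c p unfolding parity_check_code_def by blast
  finally have "(of_nat (card {b \<in> \<B>. p \<in> b \<and> c b \<noteq> 0}) :: bit) = 0" ..
  then show ?thesis unfolding supp of_nat_bit_eq_0_iff .
qed

text \<open>If a nonzero codeword exists, the infimum is attained because \<open>enat\<close> is
  well-ordered; otherwise it is the infimum of the empty set, which is infinite.\<close>

lemma minimum_distance_geI:
  assumes "\<And>c. c \<in> C \<Longrightarrow> c \<noteq> (\<lambda>_. 0) \<Longrightarrow> r \<le> real (hamming_weight c)"
  shows "ereal r \<le> ereal_of_enat (minimum_distance C)"
proof (cases "C - {\<lambda>_. 0} = {}")
  case True
  then show ?thesis by (simp add: minimum_distance_def Inf_enat_def)
next
  case False
  let ?W = "(\<lambda>c. enat (hamming_weight c)) ` (C - {\<lambda>_. 0})"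
  have "?W \<noteq> {}" using False by simp
  then have "Inf ?W \<in> ?W" unfolding Inf_enat_def by (metis LeastI ex_in_conv)
  then obtain c where "c \<in> C" "c \<noteq> (\<lambda>_. 0)" "minimum_distance C = enat (hamming_weight c)"
    unfolding minimum_distance_def by blast
  then show ?thesis using assms[of c] by simp
qed

theorem theorem4p2:
  fixes \<P> :: "'p set" and \<B> :: "'p set set"
    and s t lam mu v k :: nat and A :: "nat set" and n \<Delta> :: real
  assumes "srpg \<P> \<B> s t A lam mu"
    and "v = card \<P>"
    and "k = s * (t + 1)"
    and "\<Delta> = (real lam - real mu)\<^sup>2 + 4 * (real k - real mu)"
    and "n = real v * (real t + 1) / (real s + 1)"
  shows "ereal_of_enat (minimum_distance (parity_check_code \<P> \<B> incidence_matrix)) \<ge>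
    ereal (max
      (n * (4 * real s - 2 * real t + 2 - real lam + real mu - sqrt \<Delta>)
        / (2 * real s * (real t + 1) - real lam + real mu - sqrt \<Delta>))
      (2 * n * (4 * real s - real lam + real mu - sqrt \<Delta>)
        / ((real t + 1) * (2 * real s * (real t + 1) - real lam + real mu - sqrt \<Delta>))))"
proof -
  interpret srpg \<P> \<B> s t A lam mu by fact
  have discr_eq: "\<Delta> = discr" unfolding discr_def assms(3,4) by simp
  \<comment> \<open>Hence \<open>- lam + mu - sqrt \<Delta>\<close> equals
    \<open>- 2 * second_eigenvalue\<close>, and a factor 2 comes out of every numerator and
    denominator.\<close>
  have root: "sqrt \<Delta> = 2 * second_eigenvalue - real lam + real mu"
    unfolding discr_eq second_eigenvalue_def by (simp add: field_simps)
  show ?thesis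
  proof (rule minimum_distance_geI)
    fix c assume c: "c \<in> parity_check_code \<P> \<B> incidence_matrix" "c \<noteq> (\<lambda>_. 0)"
    \<comment> \<open>Codewords vanish outside the blocks, so the support is a set of blocks; it is
      nonempty because \<open>c\<close> is nonzero.\<close>
    interpret even_block_set \<P> \<B> s t A lam mu "{b. c b \<noteq> 0}"
      by unfold_locales
        (use c even_support_cover[OF finite_blocks c(1)] in \<open>auto simp: parity_check_code_def\<close>)
    let ?gap = "real s * (real t + 1) - second_eigenvalue"
    have n: "n = real (card \<B>)" using card_blocks_eq assms by simp
    have num: "4 * real s - 2 * real t + 2 - real lam + real mu - sqrt \<Delta> =
        2 * (2 * real s + 1 - real t - second_eigenvalue)"
      "4 * real s - real lam + real mu - sqrt \<Delta> = 2 * (2 * real s - second_eigenvalue)"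
      "2 * real s * (real t + 1) - real lam + real mu - sqrt \<Delta> = 2 * ?gap"
      unfolding root by (simp_all add: algebra_simps)
    have "n * (2 * (2 * real s + 1 - real t - second_eigenvalue)) / (2 * ?gap) \<le> real (hamming_weight c)"
      using bit_bound gap_pos by (simp add: n hamming_weight_def pos_divide_le_eq algebra_simps)
    moreover have "2 * n * (2 * (2 * real s - second_eigenvalue)) / ((real t + 1) * (2 * ?gap))
        \<le> real (hamming_weight c)"
    proof -
      have "(real t + 1) * (2 * ?gap) > 0" using gap_pos by simp
      then show ?thesis
        using parity_bound unfolding n hamming_weight_def by (simp add: pos_divide_le_eq algebra_simps)
    qed
    ultimately show "max
      (n * (4 * real s - 2 * real t + 2 - real lam + real mu - sqrt \<Delta>)
        / (2 * real s * (real t + 1) - real lam + real mu - sqrt \<Delta>))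
      (2 * n * (4 * real s - real lam + real mu - sqrt \<Delta>)
        / ((real t + 1) * (2 * real s * (real t + 1) - real lam + real mu - sqrt \<Delta>)))
      \<le> real (hamming_weight c)"
      unfolding num by simp
  qed
qed

end
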